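(* Let $H_1$ and $H_2$ be Hilbert spaces and let $(S,T)\in L(H_1,H_2)\times L(H_2,H_1)$. Then $(S,T)$ is a Fredholm pair if and only if $(T^*,S^* )\in L(H_1,H_2)\times L(H_2,H_1)$ is a Fredholm pair. Furthermore, in this case $\operatorname{ind}(T^*,S^* )=\operatorname{ind}(S,T)$.
   Context: For Hilbert spaces $H_1,H_2$, $L(H_1,H_2)$ denotes the bounded linear maps from $H_1$ to $H_2$. $N(\cdot)$ and $R(\cdot)$ denote null space and range, and $*$ the Hilbert space adjoint. A pair $(S,T)$ with $S\in L(H_1,H_2)$, $T\in L(H_2,H_1)$ is called a Fredholm pair if the following dimensions are all finite: $a=\dim N(S)/(N(S)\cap R(T))$, $b=\dim R(T)/(N(S)\cap R(T))$, $c=\dim N(T)/(N(T)\cap R(S))$, $d=\dim R(S)/(N(T)\cap R(S))$. The index of a Fredholm pair is $\operatorname{ind}(S,T)=a-b-c+d$. *)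

theory Defs
  imports "HOL-Analysis.Analysis" "Jordan_Normal_Form.Missing_VectorSpace"
begin

text \<open>The scalar field is either the reals or the complex numbers; the two instances below are,
  up to isometric isomorphism, the only ones (Gelfand-Mazur).\<close>

class hilbert_scalar = real_normed_field +
  fixes scalar_cnj :: "'a \<Rightarrow> 'a"
  assumes scalar_cnj_add: "scalar_cnj (x + y) = scalar_cnj x + scalar_cnj y"
    and scalar_cnj_mult: "scalar_cnj (x * y) = scalar_cnj x * scalar_cnj y"
    and scalar_cnj_cnj: "scalar_cnj (scalar_cnj x) = x"
    and mult_scalar_cnj: "x * scalar_cnj x = (norm x)\<^sup>2 *\<^sub>R 1"

instantiation real :: hilbert_scalar
begin
definition scalar_cnj_real :: "real \<Rightarrow> real" where "scalar_cnj_real x = x"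
instance
  by standard (simp_all add: scalar_cnj_real_def power2_eq_square)
end

instantiation complex :: hilbert_scalar
begin
definition scalar_cnj_complex :: "complex \<Rightarrow> complex" where "scalar_cnj_complex = cnj"
instance
proof
  show "x * scalar_cnj x = (norm x)\<^sup>2 *\<^sub>R 1" for x :: complex
    unfolding scalar_cnj_complex_def scaleR_conv_of_real mult_1_right by (rule complex_norm_square[symmetric])
qed (simp_all add: scalar_cnj_complex_def)
end

text \<open>A Hilbert space is a Banach space over the scalar field whose norm comes from an inner
  product (linear in the first argument). The sort \<^class>\<open>banach\<close> only provides the underlying
  real structure, which \<open>scale_of_real\<close> ties to the multiplication by scalars.\<close>

locale hilbert_space = vector_space scl
  for scl :: "'k::hilbert_scalar \<Rightarrow> 'a::banach \<Rightarrow> 'a" +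
  fixes ip :: "'a \<Rightarrow> 'a \<Rightarrow> 'k"
  assumes scale_of_real: "scl (of_real r) x = r *\<^sub>R x"
    and ip_cnj: "ip x y = scalar_cnj (ip y x)"
    and ip_add_left: "ip (x + y) z = ip x z + ip y z"
    and ip_scale_left: "ip (scl c x) y = c * ip x y"
    and ip_self: "ip x x = of_real ((norm x)\<^sup>2)"

lemma hilbert_space_real:
  "hilbert_space (*\<^sub>R) (inner :: 'a::{real_inner, banach} \<Rightarrow> 'a \<Rightarrow> real)"
  by unfold_locales
    (simp_all add: scalar_cnj_real_def inner_commute inner_add_left algebra_simps power2_norm_eq_inner)

lemma hilbert_space_complex: "hilbert_space (*) (\<lambda>x y :: complex. x * cnj y)"
  by unfold_locales
    (simp_all only: scalar_cnj_complex_def complex_norm_square scaleR_conv_of_real complex_cnj_mult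
      complex_cnj_cnj ac_simps distrib_left distrib_right mult_1_left)

definition bounded_operators ::
  "('k::hilbert_scalar \<Rightarrow> 'a::banach \<Rightarrow> 'a) \<Rightarrow> ('k \<Rightarrow> 'b::banach \<Rightarrow> 'b) \<Rightarrow> ('a \<Rightarrow> 'b) set" where
  "bounded_operators scl1 scl2 =
    {S. Vector_Spaces.linear scl1 scl2 S \<and> (\<exists>C. \<forall>x. norm (S x) \<le> C * norm x)}"

definition hilbert_adjoint ::
  "('a \<Rightarrow> 'a \<Rightarrow> 'k) \<Rightarrow> ('b \<Rightarrow> 'b \<Rightarrow> 'k) \<Rightarrow> ('a \<Rightarrow> 'b) \<Rightarrow> 'b \<Rightarrow> 'a" where
  "hilbert_adjoint ip1 ip2 S = (THE S'. \<forall>x y. ip2 (S x) y = ip1 x (S' y))"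

definition null_space :: "('a \<Rightarrow> 'b::zero) \<Rightarrow> 'a set" where
  "null_space S = {x. S x = 0}"

definition scalar_ring :: "'k::field ring" where
  "scalar_ring = \<lparr>carrier = UNIV, mult = (*), one = 1, zero = 0, add = (+)\<rparr>"

text \<open>The quotient of the subspace \<open>V\<close> by the subspace \<open>W \<subseteq> V\<close>; its vectors are the
  cosets of \<open>W\<close>. Multiplying \<open>x + W\<close> elementwise by \<open>0\<close> gives \<open>{0}\<close> rather than the
  zero vector \<open>W\<close> of the quotient, so the multiplication by scalars adds \<open>W\<close> again. The ring
  multiplication of the record is not used in modules.\<close>

definition quotient_space ::
  "('k::field \<Rightarrow> 'a::ab_group_add \<Rightarrow> 'a) \<Rightarrow> 'a set \<Rightarrow> 'a set \<Rightarrow> ('k, 'a set) module" where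
  "quotient_space scl V W =
    \<lparr>carrier = (\<lambda>x. x +o W) ` V, mult = undefined, one = undefined,
     zero = W, add = (+), smult = (\<lambda>c X. scl c ` X + W)\<rparr>"

lemma field_scalar_ring: "field (scalar_ring :: 'k::field ring)"
proof (rule cring.cring_fieldI2)
  show "cring (scalar_ring :: 'k ring)"
  proof (rule cringI)
    show "abelian_group (scalar_ring :: 'k ring)"
      by (rule abelian_groupI)
        (auto simp: scalar_ring_def add.assoc add.commute intro: exI[of _ "- _"] left_minus)
    show "Group.comm_monoid (scalar_ring :: 'k ring)"
      by (rule comm_monoidI) (auto simp: scalar_ring_def mult.assoc mult.commute)
  qed (simp add: scalar_ring_def distrib_right)
  show "\<zero>\<^bsub>scalar_ring :: 'k ring\<^esub> \<noteq> \<one>\<^bsub>scalar_ring\<^esub>"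
    by (simp add: scalar_ring_def)
  fix a :: 'k
  assume "a \<noteq> \<zero>\<^bsub>scalar_ring\<^esub>"
  then show "\<exists>b\<in>carrier scalar_ring. a \<otimes>\<^bsub>scalar_ring\<^esub> b = \<one>\<^bsub>scalar_ring\<^esub>"
    by (auto simp: scalar_ring_def intro!: exI[of _ "inverse a"])
qed

lemma vectorspace_quotient_space:
  fixes scl :: "'k::field \<Rightarrow> 'a::ab_group_add \<Rightarrow> 'a"
  assumes "vector_space scl" "module.subspace scl V" "module.subspace scl W" "W \<subseteq> V"
  shows "vectorspace scalar_ring (quotient_space scl V W)"
proof -
  interpret vector_space scl by fact
  have V: "0 \<in> V" "\<And>x y. x \<in> V \<Longrightarrow> y \<in> V \<Longrightarrow> x + y \<in> V" "\<And>c x. x \<in> V \<Longrightarrow> scl c x \<in> V"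
    and W: "0 \<in> W" "\<And>x y. x \<in> W \<Longrightarrow> y \<in> W \<Longrightarrow> x + y \<in> W" "\<And>c x. x \<in> W \<Longrightarrow> scl c x \<in> W"
    using assms(2,3) by (auto simp: subspace_def)
  have WW: "W + W = W"
    using W by (force simp: set_plus_def)
  have add: "(x +o W) + (y +o W) = (x + y) +o W" for x y
    by (simp add: set_plus_rearrange WW)
  have smult: "scl c ` (x +o W) + W = scl c x +o W" for c x
  proof (rule subset_antisym; rule subsetI)
    fix z assume "z \<in> scl c ` (x +o W) + W"
    then obtain w v where "w \<in> W" "v \<in> W" "z = scl c (x + w) + v"
      by (auto simp: set_plus_def elt_set_plus_def)
    then show "z \<in> scl c x +o W"
      using W by (auto simp: elt_set_plus_def scale_right_distrib add.assoc)
  next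
    fix z assume "z \<in> scl c x +o W"
    then obtain w where "w \<in> W" "z = scl c (x + 0) + w"
      by (auto simp: elt_set_plus_def)
    then show "z \<in> scl c ` (x +o W) + W"
      using W(1) unfolding set_plus_def elt_set_plus_def by blast
  qed
  have zero: "W = 0 +o W"
    by simp
  have neg: "- x \<in> V" if "x \<in> V" for x
    using V(3)[OF that, of "- 1"] by simp
  let ?Q = "quotient_space scl V W"
  have carrier: "X \<in> carrier ?Q \<longleftrightarrow> (\<exists>x\<in>V. X = x +o W)" for X
    by (auto simp: quotient_space_def)
  have ops: "X \<oplus>\<^bsub>?Q\<^esub> Y = X + Y" "\<zero>\<^bsub>?Q\<^esub> = 0 +o W" "c \<odot>\<^bsub>?Q\<^esub> X = scl c ` X + W" for X Y c
    using zero by (simp_all add: quotient_space_def)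
  have "abelian_group ?Q"
  proof (rule abelian_groupI)
    fix X assume "X \<in> carrier ?Q"
    then obtain x where x: "x \<in> V" "X = x +o W" by (auto simp: carrier)
    have "(- x +o W) \<oplus>\<^bsub>?Q\<^esub> X = \<zero>\<^bsub>?Q\<^esub>" by (simp add: ops x(2) add del: set_zero_plus2)
    moreover have "- x +o W \<in> carrier ?Q" using neg[OF x(1)] by (auto simp: carrier)
    ultimately show "\<exists>Y\<in>carrier ?Q. Y \<oplus>\<^bsub>?Q\<^esub> X = \<zero>\<^bsub>?Q\<^esub>" by blast
  next
    fix X Y assume "X \<in> carrier ?Q" "Y \<in> carrier ?Q"
    then show "X \<oplus>\<^bsub>?Q\<^esub> Y \<in> carrier ?Q"
      unfolding carrier ops using V(2) add by metis
  next
    show "\<zero>\<^bsub>?Q\<^esub> \<in> carrier ?Q"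
      unfolding carrier ops using V(1) by blast
  next
    fix X assume "X \<in> carrier ?Q"
    then show "\<zero>\<^bsub>?Q\<^esub> \<oplus>\<^bsub>?Q\<^esub> X = X"
      unfolding carrier ops using add by (metis add_0)
  qed (simp_all add: ops add.assoc add.commute add.left_commute)
  moreover have "cring (scalar_ring :: 'k ring)"
    by (rule fieldE(1)) (rule field_scalar_ring)
  ultimately have "Module.module scalar_ring ?Q"
  proof (intro moduleI)
    fix c X assume "X \<in> carrier ?Q"
    then show "c \<odot>\<^bsub>?Q\<^esub> X \<in> carrier ?Q"
      unfolding carrier ops using V(3) smult by metis
  next
    fix c d X assume "X \<in> carrier ?Q"
    then obtain x where x: "X = x +o W" by (auto simp: carrier)
    show "(c \<oplus>\<^bsub>scalar_ring\<^esub> d) \<odot>\<^bsub>?Q\<^esub> X = c \<odot>\<^bsub>?Q\<^esub> X \<oplus>\<^bsub>?Q\<^esub> d \<odot>\<^bsub>?Q\<^esub> X"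
      by (simp add: ops x smult add scalar_ring_def scale_left_distrib[symmetric])
    show "(c \<otimes>\<^bsub>scalar_ring\<^esub> d) \<odot>\<^bsub>?Q\<^esub> X = c \<odot>\<^bsub>?Q\<^esub> (d \<odot>\<^bsub>?Q\<^esub> X)"
      by (simp add: ops x smult scalar_ring_def)
  next
    fix c X Y assume "X \<in> carrier ?Q" "Y \<in> carrier ?Q"
    then obtain x y where "X = x +o W" "Y = y +o W" by (auto simp: carrier)
    then show "c \<odot>\<^bsub>?Q\<^esub> (X \<oplus>\<^bsub>?Q\<^esub> Y) = c \<odot>\<^bsub>?Q\<^esub> X \<oplus>\<^bsub>?Q\<^esub> c \<odot>\<^bsub>?Q\<^esub> Y"
      by (simp add: ops smult add scale_right_distrib)
  next
    fix X assume "X \<in> carrier ?Q"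
    then obtain x where "X = x +o W" by (auto simp: carrier)
    then show "\<one>\<^bsub>scalar_ring\<^esub> \<odot>\<^bsub>?Q\<^esub> X = X"
      using smult[of 1 x] by (simp add: ops scalar_ring_def)
  qed
  then show ?thesis
    by (intro vectorspace.intro field_scalar_ring)
qed

abbreviation fin_dim_quotient where
  "fin_dim_quotient scl V W \<equiv> vectorspace.fin_dim scalar_ring (quotient_space scl V W)"

abbreviation dim_quotient where
  "dim_quotient scl V W \<equiv> vectorspace.dim scalar_ring (quotient_space scl V W)"

definition fredholm_pair ::
  "('k::hilbert_scalar \<Rightarrow> 'a::banach \<Rightarrow> 'a) \<Rightarrow> ('k \<Rightarrow> 'b::banach \<Rightarrow> 'b) \<Rightarrow>
    ('a \<Rightarrow> 'b) \<Rightarrow> ('b \<Rightarrow> 'a) \<Rightarrow> bool" where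
  "fredholm_pair scl1 scl2 S T \<longleftrightarrow>
    S \<in> bounded_operators scl1 scl2 \<and> T \<in> bounded_operators scl2 scl1 \<and>
    fin_dim_quotient scl1 (null_space S) (null_space S \<inter> range T) \<and>
    fin_dim_quotient scl1 (range T) (null_space S \<inter> range T) \<and>
    fin_dim_quotient scl2 (null_space T) (null_space T \<inter> range S) \<and>
    fin_dim_quotient scl2 (range S) (null_space T \<inter> range S)"

definition fredholm_index ::
  "('k::hilbert_scalar \<Rightarrow> 'a::banach \<Rightarrow> 'a) \<Rightarrow> ('k \<Rightarrow> 'b::banach \<Rightarrow> 'b) \<Rightarrow>
    ('a \<Rightarrow> 'b) \<Rightarrow> ('b \<Rightarrow> 'a) \<Rightarrow> int" where
  "fredholm_index scl1 scl2 S T =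
    int (dim_quotient scl1 (null_space S) (null_space S \<inter> range T))
    - int (dim_quotient scl1 (range T) (null_space S \<inter> range T))
    - int (dim_quotient scl2 (null_space T) (null_space T \<inter> range S))
    + int (dim_quotient scl2 (range S) (null_space T \<inter> range S))"

end

theory Submission
  imports Defs
begin

text \<open>Write \<open>M\<close> for the null space of \<open>S\<close> and \<open>N\<close> for the range of \<open>T\<close>; the other two subspaces
  are the same with \<open>S\<close> and \<open>T\<close> exchanged. If \<open>M\<close> and \<open>N\<close> are closed and the ranges of the adjoints
  are the orthogonal complements of the null spaces, then passing to the adjoint pair replaces \<open>M\<close>
  by the orthogonal complement of \<open>N\<close> and \<open>N\<close> by that of \<open>M\<close>. Hence the theorem says that
  the quotient of \<open>M\<close> by \<open>M \<inter> N\<close> has the same dimension as the quotient of the complement of \<open>N\<close> by the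
  intersection of both complements. One inequality is linear algebra: among the vectors
  orthogonal to \<open>N\<close>, orthogonality to \<open>M\<close> amounts to finitely many linear equations, one for each
  generator of \<open>M\<close> modulo \<open>M \<inter> N\<close> (\<open>perp_quotient_dim_le\<close>). The other inequality is the first one
  applied to the complements, because closed subspaces are their own double complements
  (\<open>perp_quotient_dim_eq\<close>). So each of the four dimensions is preserved, and with them
  the index.

  The analytic part is to obtain the closed ranges from finite dimensions alone. The null space \<open>M\<close>
  is closed. Since \<open>M\<close> and \<open>N\<close> differ from their intersection by finite dimensions, \<open>N\<close> has an
  algebraic complement \<open>D\<close> in the whole space that is closed: a finite-dimensional piece of \<open>M\<close>
  together with the orthogonal complement of \<open>M + N\<close> (\<open>closed_complement_exists\<close>). By
  the open mapping theorem, the component in the range of \<open>T\<close> along \<open>D\<close> has a preimage of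
  controlled size (\<open>bounded_preimage_mod_complement\<close>). This makes the range closed, and through
  the Riesz representation theorem it makes the range of the adjoint fill the
  orthogonal complement of the null space (\<open>range_adjoint_of_closed_complement\<close>).

  The converse implication is the same statement for the adjoint pair, whose adjoint pair is
  \<open>(S, T)\<close> again.\<close>

section \<open>Open mappings of Banach spaces\<close>

text \<open>One step of successive approximation: by the Baire category theorem the image of some ball is
  dense in a neighbourhood of a point; differences of two points of that neighbourhood reach every
  direction, and homogeneity turns this into an approximate solution of \<open>A x = y\<close> whose size is
  controlled by \<open>y\<close> and whose error is half of \<open>y\<close>.\<close>

lemma bounded_linear_surj_approximate_preimage:
  fixes A :: "'x::banach \<Rightarrow> 'y::banach"
  assumes A: "bounded_linear A" and surj: "surj A"
  shows "\<exists>C. \<forall>y. \<exists>x. norm x \<le> C * norm y \<and> norm (y - A x) \<le> norm y / 2"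
proof -
  interpret A: bounded_linear A by fact
  let ?K = "\<lambda>n::nat. closure (A ` ball 0 (real n))"
  have "y \<in> \<Union> (range ?K)" for y
  proof -
    obtain x where x: "A x = y" using surj by (metis surjD)
    obtain n :: nat where "norm x < real n" using reals_Archimedean2 by blast
    then have "y \<in> ?K n" using closure_subset[of "A ` ball 0 (real n)"] x by auto
    then show ?thesis by blast
  qed
  then have "\<Union> (range ?K) = UNIV" by blast
  then have "\<exists>n. interior (?K n) \<noteq> {}"
    using Baire_category_alt[of "euclidean :: 'y topology" "range ?K"]
      completely_metrizable_space_euclidean by auto
  then obtain n y0 where "y0 \<in> interior (?K n)" by blast
  then obtain e where e: "e > 0" "ball y0 e \<subseteq> ?K n"
    using mem_interior by blast
  have small: "\<exists>x. norm x \<le> 2 * real n \<and> norm (y - A x) < d"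
    if y: "norm y < e" and d: "d > 0" for y d
  proof -
    have "y0 + y \<in> ?K n" "y0 \<in> ?K n"
      using e y by (auto simp: dist_norm subset_iff)
    then obtain x1 x2 where x: "norm x1 < real n" "dist (A x1) (y0 + y) < d / 2"
      "norm x2 < real n" "dist (A x2) y0 < d / 2"
      using d by (auto simp: closure_approachable dest!: spec[of _ "d / 2"])
    have "norm (x1 - x2) \<le> 2 * real n"
      using norm_triangle_ineq4[of x1 x2] x by simp
    moreover have "y - A (x1 - x2) = (A x2 - y0) - (A x1 - (y0 + y))"
      by (simp add: A.diff)
    then have "norm (y - A (x1 - x2)) \<le> norm (A x2 - y0) + norm (A x1 - (y0 + y))"
      by (metis norm_triangle_ineq4)
    then have "norm (y - A (x1 - x2)) < d"
      using x(2,4) unfolding dist_norm by linarith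
    ultimately show ?thesis by blast
  qed
  have "\<exists>x. norm x \<le> (4 * real n / e) * norm y \<and> norm (y - A x) \<le> norm y / 2" for y
  proof (cases "y = 0")
    case True
    then show ?thesis by (intro exI[of _ 0]) simp
  next
    case False
    define r where "r = e / (2 * norm y)"
    have r: "r > 0" using e False by (simp add: r_def)
    have "norm (r *\<^sub>R y) < e" using e False by (simp add: r_def)
    then obtain x where x: "norm x \<le> 2 * real n" "norm (r *\<^sub>R y - A x) < e / 4"
      using small[of "r *\<^sub>R y" "e / 4"] e by auto
    define x' where "x' = inverse r *\<^sub>R x"
    have "norm x' = norm x / r" using r by (simp add: x'_def divide_simps)
    also have "\<dots> \<le> 2 * real n / r" using x r by (simp add: divide_right_mono)
    also have "\<dots> = (4 * real n / e) * norm y" using e False by (simp add: r_def)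
    finally have 1: "norm x' \<le> (4 * real n / e) * norm y" .
    have "y - A x' = inverse r *\<^sub>R (r *\<^sub>R y - A x)"
      using r by (simp add: x'_def A.scaleR scaleR_diff_right)
    then have "norm (y - A x') = norm (r *\<^sub>R y - A x) / r"
      using r by (simp add: divide_simps)
    also have "\<dots> \<le> (e / 4) / r" using x r by (intro divide_right_mono) auto
    also have "\<dots> = norm y / 2" using e False by (simp add: r_def)
    finally show ?thesis using 1 by blast
  qed
  then show ?thesis by blast
qed

text \<open>The quantitative form of the open mapping theorem: the errors of the approximate solutions
  decay geometrically, so their sum is an exact solution.\<close>

lemma bounded_linear_surj_bounded_preimage:
  fixes A :: "'x::banach \<Rightarrow> 'y::banach"
  assumes A: "bounded_linear A" and surj: "surj A"
  shows "\<exists>C. \<forall>y. \<exists>x. A x = y \<and> norm x \<le> C * norm y"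
proof -
  interpret A: bounded_linear A by fact
  obtain C g where g: "\<And>y. norm (g y) \<le> C * norm y" "\<And>y. norm (y - A (g y)) \<le> norm y / 2"
    using bounded_linear_surj_approximate_preimage[OF assms] by metis
  have "\<exists>x. A x = y \<and> norm x \<le> (2 * \<bar>C\<bar>) * norm y" for y
  proof -
    define u where "u n = ((\<lambda>y. y - A (g y)) ^^ n) y" for n
    have u0: "u 0 = y" and uS: "u (Suc n) = u n - A (g (u n))" for n
      by (simp_all add: u_def)
    have u_le: "norm (u n) \<le> norm y * (1 / 2) ^ n" for n
    proof (induction n)
      case (Suc n)
      then show ?case using g(2)[of "u n"] by (simp add: uS)
    qed (simp add: u0)
    have g_le: "norm (g (u n)) \<le> \<bar>C\<bar> * norm y * (1 / 2) ^ n" for n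
    proof -
      have "norm (g (u n)) \<le> \<bar>C\<bar> * norm (u n)"
        using g(1)[of "u n"] mult_right_mono[OF abs_ge_self[of C] norm_ge_zero[of "u n"]] by linarith
      also have "\<dots> \<le> \<bar>C\<bar> * (norm y * (1 / 2) ^ n)"
        by (intro mult_left_mono u_le) simp
      finally show ?thesis by simp
    qed
    have geo: "(\<lambda>n. \<bar>C\<bar> * norm y * (1 / 2) ^ n) sums (\<bar>C\<bar> * norm y * 2)"
      using geometric_sums[of "1 / 2 :: real"] by (intro sums_mult) simp
    have sn: "summable (\<lambda>n. norm (g (u n)))"
      by (rule summable_comparison_test'[OF sums_summable[OF geo], of 0]) (use g_le in simp)
    then have s: "summable (\<lambda>n. g (u n))" by (rule summable_norm_cancel)
    have "norm (\<Sum>n. g (u n)) \<le> (\<Sum>n. norm (g (u n)))" by (rule summable_norm[OF sn])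
    also have "\<dots> \<le> (\<Sum>n. \<bar>C\<bar> * norm y * (1 / 2) ^ n)"
      by (rule suminf_le[OF g_le sn sums_summable[OF geo]])
    also have "\<dots> = \<bar>C\<bar> * norm y * 2" using geo by (simp add: sums_iff)
    finally have le: "norm (\<Sum>n. g (u n)) \<le> (2 * \<bar>C\<bar>) * norm y" by (simp add: mult_ac)
    have "(\<lambda>n. norm y * (1 / 2) ^ n) \<longlonglongrightarrow> norm y * 0"
      by (intro tendsto_mult tendsto_const LIMSEQ_power_zero) simp
    then have "u \<longlonglongrightarrow> 0"
      using u_le by (intro Lim_null_comparison[of u]) auto
    then have "(\<lambda>n. u n - u (Suc n)) sums (u 0 - 0)" by (rule telescope_sums')
    then have "(\<lambda>n. A (g (u n))) sums y" by (simp add: uS u0)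
    moreover have "(\<lambda>n. A (g (u n))) sums A (\<Sum>n. g (u n))"
      by (rule A.sums[OF summable_sums[OF s]])
    ultimately show ?thesis using le sums_unique2 by blast
  qed
  then show ?thesis by blast
qed

section \<open>Geometry of Hilbert spaces\<close>

lemma scalar_cnj_zero [simp]: "scalar_cnj (0 :: 'k::hilbert_scalar) = 0"
  using scalar_cnj_add[of "0 :: 'k" 0] by simp

lemma norm_scalar_cnj [simp]: "norm (scalar_cnj x) = norm (x :: 'k::hilbert_scalar)"
proof (cases "x = 0")
  case False
  have "norm x * norm (scalar_cnj x) = norm x * norm x"
    by (simp add: norm_mult[symmetric] mult_scalar_cnj power2_eq_square)
  then show ?thesis using False by simp
qed simp

context hilbert_space
begin

lemma ip_zero_left [simp]: "ip 0 y = 0"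
  using ip_add_left[of 0 0 y] by simp

lemma ip_minus_left: "ip (- x) y = - ip x y"
  using ip_add_left[of x "- x" y] by (simp add: eq_neg_iff_add_eq_0 add.commute)

lemma ip_diff_left: "ip (x - y) z = ip x z - ip y z"
  using ip_add_left[of x "- y" z] by (simp add: ip_minus_left)

lemma ip_add_right: "ip x (y + z) = ip x y + ip x z"
  by (subst (1 2 3) ip_cnj) (simp add: ip_add_left scalar_cnj_add)

lemma ip_scale_right: "ip x (scl c y) = scalar_cnj c * ip x y"
  by (subst (1 2) ip_cnj) (simp add: ip_scale_left scalar_cnj_mult)

lemma ip_zero_right [simp]: "ip x 0 = 0"
  using ip_add_right[of x 0 0] by simp

lemma ip_diff_right: "ip x (y - z) = ip x y - ip x z"
  using ip_add_right[of x "y - z" z] by simp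

lemma norm_ip_commute: "norm (ip x y) = norm (ip y x)"
  by (subst ip_cnj) simp

lemma ip_eq_zero_commute: "ip x y = 0 \<longleftrightarrow> ip y x = 0"
  using norm_ip_commute[of x y] by (metis norm_eq_zero)

lemma ip_self_eq_zero [simp]: "ip x x = 0 \<longleftrightarrow> x = 0"
  by (simp add: ip_self)

lemma ip_eqI: "x = y" if "\<And>z. ip z x = ip z y"
proof -
  have "ip (x - y) (x - y) = 0" using that[of "x - y"] by (simp add: ip_diff_right)
  then show ?thesis by simp
qed

lemma parallelogram:
  fixes x y :: 'a
  shows "(norm (x + y))\<^sup>2 + (norm (x - y))\<^sup>2 = 2 * (norm x)\<^sup>2 + 2 * (norm y)\<^sup>2"
proof -
  have "ip (x + y) (x + y) + ip (x - y) (x - y) = 2 * ip x x + 2 * ip y y"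
    unfolding ip_add_left ip_add_right ip_diff_left ip_diff_right by simp
  then have "of_real ((norm (x + y))\<^sup>2 + (norm (x - y))\<^sup>2) =
      (of_real (2 * (norm x)\<^sup>2 + 2 * (norm y)\<^sup>2) :: 'k)"
    by (simp only: ip_self of_real_add of_real_mult of_real_numeral)
  then show ?thesis by (simp only: of_real_eq_iff)
qed

text \<open>Pythagoras for the projection of \<open>u\<close> to the line through \<open>z\<close>. Both the Cauchy-Schwarz
  inequality and the orthogonality of best approximations come from this identity.\<close>

lemma norm_diff_projection:
  assumes "z \<noteq> 0"
  shows "(norm (u - scl (ip u z / of_real ((norm z)\<^sup>2)) z))\<^sup>2 =
    (norm u)\<^sup>2 - (norm (ip u z))\<^sup>2 / (norm z)\<^sup>2"
proof -
  define c where "c = ip u z / of_real ((norm z)\<^sup>2)"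
  define w where "w = u - scl c z"
  have "ip w z = 0"
    using assms by (simp add: w_def ip_diff_left ip_scale_left c_def ip_self)
  have "ip w w = ip w (u - scl c z)" by (simp add: w_def)
  also have "\<dots> = ip w u"
    using \<open>ip w z = 0\<close> by (simp add: ip_diff_right ip_scale_right)
  also have "\<dots> = ip u u - ip u z * scalar_cnj (ip u z) / of_real ((norm z)\<^sup>2)"
    by (simp add: w_def ip_diff_left ip_scale_left c_def ip_cnj[of z u])
  finally have "of_real ((norm w)\<^sup>2) =
      (of_real ((norm u)\<^sup>2 - (norm (ip u z))\<^sup>2 / (norm z)\<^sup>2) :: 'k)"
    by (simp add: ip_self mult_scalar_cnj scaleR_conv_of_real)
  then show ?thesis
    by (simp only: of_real_eq_iff w_def c_def)
qed

lemma cauchy_schwarz: "norm (ip x y) \<le> norm x * norm y"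
proof (cases "y = 0")
  case False
  have "0 \<le> (norm x)\<^sup>2 - (norm (ip x y))\<^sup>2 / (norm y)\<^sup>2"
    unfolding norm_diff_projection[OF False, symmetric] by simp
  then have "(norm (ip x y))\<^sup>2 \<le> (norm x * norm y)\<^sup>2"
    using False by (simp add: divide_simps power_mult_distrib)
  then show ?thesis by (rule power2_le_imp_le) simp
qed simp

lemma norm_scale: "norm (scl c x) = norm c * norm x"
proof -
  have "ip (scl c x) (scl c x) = (c * scalar_cnj c) * ip x x"
    by (simp add: ip_scale_left ip_scale_right)
  then have "of_real ((norm (scl c x))\<^sup>2) = (of_real ((norm c * norm x)\<^sup>2) :: 'k)"
    by (simp add: ip_self mult_scalar_cnj scaleR_conv_of_real power_mult_distrib)
  then have "(norm (scl c x))\<^sup>2 = (norm c * norm x)\<^sup>2" by (simp only: of_real_eq_iff)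
  then show ?thesis by (simp add: power2_eq_iff_nonneg)
qed

lemma scaleR_ip: "ip (r *\<^sub>R x) y = r *\<^sub>R ip x y"
  by (simp only: scale_of_real[symmetric] ip_scale_left scaleR_conv_of_real)

lemma bounded_linear_ip_left: "bounded_linear (\<lambda>x. ip x y)"
  by (rule bounded_linear_intro[of _ "norm y"])
    (simp_all add: ip_add_left scaleR_ip cauchy_schwarz)

lemma bounded_linear_scale_left: "bounded_linear (\<lambda>c. scl c x)"
proof (rule bounded_linear_intro[of _ "norm x"])
  show "scl (r *\<^sub>R c) x = r *\<^sub>R scl c x" for r c
    by (simp add: scaleR_conv_of_real scale_of_real[symmetric])
qed (simp_all add: scale_left_distrib norm_scale)

definition perp :: "'a set \<Rightarrow> 'a set" where
  "perp M = {x. \<forall>y\<in>M. ip x y = 0}"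

lemma perp_antimono: "M \<subseteq> N \<Longrightarrow> perp N \<subseteq> perp M"
  by (auto simp: perp_def)

lemma subspace_perp: "subspace (perp M)"
  by (auto simp: perp_def subspace_def ip_add_left ip_scale_left)

lemma closed_perp: "closed (perp M)"
proof -
  have "perp M = (\<Inter>y\<in>M. (\<lambda>x. ip x y) -` {0})" by (auto simp: perp_def)
  also have "closed \<dots>"
    by (intro closed_INT ballI closed_vimage closed_singleton
        linear_continuous_on bounded_linear_ip_left)
  finally show ?thesis .
qed

lemma perp_perp_superset: "M \<subseteq> perp (perp M)"
  by (auto simp: perp_def ip_eq_zero_commute)

lemma perp_Int_self: "x \<in> perp M \<Longrightarrow> x \<in> M \<Longrightarrow> x = 0"
  by (auto simp: perp_def)

lemma perp_span: "perp (span M) = perp M"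
proof
  show "perp (span M) \<subseteq> perp M" by (intro perp_antimono span_superset)
  have "M \<subseteq> perp (perp M)" by (rule perp_perp_superset)
  then have "span M \<subseteq> perp (perp M)" by (rule span_minimal) (rule subspace_perp)
  then show "perp M \<subseteq> perp (span M)"
    using perp_antimono perp_perp_superset by blast
qed

text \<open>A minimizing sequence for the distance to \<open>M\<close> is Cauchy by the parallelogram law, because
  midpoints of its members lie in \<open>M\<close> again.\<close>

lemma exists_best_approximation:
  assumes M: "subspace M" "closed M"
  shows "\<exists>m\<in>M. \<forall>m'\<in>M. norm (x - m) \<le> norm (x - m')"
proof -
  define d where "d = (INF m\<in>M. (norm (x - m))\<^sup>2)"
  have ne: "M \<noteq> {}" using subspace_0[OF M(1)] by blast
  have bdd: "bdd_below ((\<lambda>m. (norm (x - m))\<^sup>2) ` M)" by (rule bdd_belowI[of _ 0]) auto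
  have d_le: "d \<le> (norm (x - m))\<^sup>2" if "m \<in> M" for m
    unfolding d_def by (rule cINF_lower[OF bdd that])
  have "\<exists>m\<in>M. (norm (x - m))\<^sup>2 < d + inverse (real (Suc n))" for n
    unfolding cINF_less_iff[OF ne bdd, symmetric] d_def[symmetric] by simp
  then obtain f where f: "\<And>n. f n \<in> M"
    "\<And>n. (norm (x - f n))\<^sup>2 < d + inverse (real (Suc n))"
    by metis
  have gap: "(norm (f m - f n))\<^sup>2 \<le> 2 * inverse (real (Suc m)) + 2 * inverse (real (Suc n))" for m n
  proof -
    have "scl (of_real (1 / 2)) (f m + f n) \<in> M"
      by (intro subspace_scale subspace_add M f)
    then have half: "d \<le> (norm (x - (1 / 2) *\<^sub>R (f m + f n)))\<^sup>2"
      unfolding scale_of_real by (rule d_le)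
    have "(x - f n) + (x - f m) = 2 *\<^sub>R (x - (1 / 2) *\<^sub>R (f m + f n))"
      by (simp add: scaleR_2 algebra_simps)
    then have "(norm ((x - f n) + (x - f m)))\<^sup>2 = (2 * norm (x - (1 / 2) *\<^sub>R (f m + f n)))\<^sup>2"
      by (simp only: norm_scaleR abs_numeral)
    then have sum: "(norm ((x - f n) + (x - f m)))\<^sup>2 = 4 * (norm (x - (1 / 2) *\<^sub>R (f m + f n)))\<^sup>2"
      by (simp only: power_mult_distrib four_x_squared)
    have diff: "(x - f n) - (x - f m) = f m - f n" by simp
    have "(norm ((x - f n) + (x - f m)))\<^sup>2 + (norm (f m - f n))\<^sup>2 =
        2 * (norm (x - f n))\<^sup>2 + 2 * (norm (x - f m))\<^sup>2"
      using parallelogram[of "x - f n" "x - f m"] unfolding diff .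
    then show ?thesis
      using half sum f(2)[of m] f(2)[of n] by linarith
  qed
  have "Cauchy f"
  proof (rule metric_CauchyI)
    fix e :: real
    assume e: "e > 0"
    then obtain N where N: "inverse (real (Suc N)) < e\<^sup>2 / 4"
      using reals_Archimedean[of "e\<^sup>2 / 4"] by auto
    have "dist (f m) (f n) < e" if "m \<ge> N" "n \<ge> N" for m n
    proof -
      have "inverse (real (Suc m)) \<le> inverse (real (Suc N))"
        "inverse (real (Suc n)) \<le> inverse (real (Suc N))"
        using that by (auto simp: le_imp_inverse_le)
      then have "(norm (f m - f n))\<^sup>2 < e\<^sup>2" using gap[of m n] N by linarith
      then show ?thesis using e by (simp add: dist_norm power2_less_imp_less)
    qed
    then show "\<exists>N. \<forall>m\<ge>N. \<forall>n\<ge>N. dist (f m) (f n) < e" by blast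
  qed
  then obtain m where lim: "f \<longlonglongrightarrow> m" using Cauchy_convergent convergent_def by blast
  have "m \<in> M" by (rule closed_sequentially[OF M(2) _ lim]) (simp add: f(1))
  have "(\<lambda>n. (norm (x - f n))\<^sup>2) \<longlonglongrightarrow> (norm (x - m))\<^sup>2"
    by (intro tendsto_intros lim)
  moreover have "(\<lambda>n. d + inverse (real (Suc n))) \<longlonglongrightarrow> d"
    using tendsto_add[OF tendsto_const LIMSEQ_inverse_real_of_nat, of d] by simp
  ultimately have "(norm (x - m))\<^sup>2 \<le> d"
    by (rule LIMSEQ_le) (intro exI[of _ 0] allI impI less_imp_le f(2))
  then have "norm (x - m) \<le> norm (x - m')" if "m' \<in> M" for m'
    using d_le[OF that] by (intro power2_le_imp_le[OF order_trans norm_ge_zero])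
  then show ?thesis using \<open>m \<in> M\<close> by blast
qed

text \<open>A best approximation cannot be improved along any line of \<open>M\<close>, so its error is orthogonal
  to \<open>M\<close>.\<close>

lemma perp_decomposition:
  assumes M: "subspace M" "closed M"
  shows "\<exists>m\<in>M. x - m \<in> perp M"
proof -
  obtain m where m: "m \<in> M" "\<And>m'. m' \<in> M \<Longrightarrow> norm (x - m) \<le> norm (x - m')"
    using exists_best_approximation[OF assms] by blast
  have "ip (x - m) z = 0" if z: "z \<in> M" for z
  proof (cases "z = 0")
    case False
    let ?c = "ip (x - m) z / of_real ((norm z)\<^sup>2)"
    have "m + scl ?c z \<in> M" by (intro subspace_add subspace_scale M m z)
    then have "(norm (x - m))\<^sup>2 \<le> (norm ((x - m) - scl ?c z))\<^sup>2"
      using m(2) by (simp add: diff_diff_eq power_mono)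
    then have "(norm (ip (x - m) z))\<^sup>2 / (norm z)\<^sup>2 \<le> 0"
      unfolding norm_diff_projection[OF False] by linarith
    then show ?thesis using False by (simp add: divide_le_0_iff)
  qed simp
  then show ?thesis using m(1) by (auto simp: perp_def)
qed

text \<open>The orthogonal projection is linear because the decomposition is unique, and the
  Cauchy-Schwarz inequality bounds it by \<open>1\<close>.\<close>

lemma bounded_linear_projection:
  assumes M: "subspace M" "closed M"
  shows "\<exists>P. bounded_linear P \<and> (\<forall>x. P x \<in> M) \<and> (\<forall>x\<in>M. P x = x)"
proof -
  obtain P where P: "\<And>x. P x \<in> M" "\<And>x. x - P x \<in> perp M"
    using perp_decomposition[OF M] by metis
  have eq: "P x = m" if "m \<in> M" "x - m \<in> perp M" for x m
  proof -
    have "P x - m \<in> M" by (intro subspace_diff M P that)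
    moreover have "(x - m) - (x - P x) \<in> perp M"
      by (intro subspace_diff[OF subspace_perp] P that)
    then have "P x - m \<in> perp M" by simp
    ultimately show ?thesis using perp_Int_self by fastforce
  qed
  have "bounded_linear P"
  proof (rule bounded_linear_intro[of _ 1])
    fix x y
    have "(x - P x) + (y - P y) \<in> perp M" by (intro subspace_add[OF subspace_perp] P)
    then show "P (x + y) = P x + P y"
      by (intro eq subspace_add M P) (simp add: algebra_simps)
  next
    fix r x
    have "scl (of_real r) (x - P x) \<in> perp M" by (intro subspace_scale[OF subspace_perp] P)
    then have "scl (of_real r) x - scl (of_real r) (P x) \<in> perp M"
      by (simp only: scale_right_diff_distrib)
    then have "P (scl (of_real r) x) = scl (of_real r) (P x)"
      by (intro eq subspace_scale M P)
    then show "P (r *\<^sub>R x) = r *\<^sub>R P x" by (simp only: scale_of_real)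
  next
    fix x
    have "ip (x - P x) (P x) = 0" using P[of x] by (simp add: perp_def)
    then have "norm (ip (P x) (P x)) \<le> norm x * norm (P x)"
      using cauchy_schwarz[of x "P x"] by (simp add: ip_diff_left)
    then have "norm (P x) * norm (P x) \<le> norm x * norm (P x)"
      by (simp add: ip_self norm_power power2_eq_square norm_mult)
    then show "norm (P x) \<le> norm x * 1"
      by (cases "P x = 0") simp_all
  qed
  moreover have "P x = x" if "x \<in> M" for x
    using that by (intro eq) (simp_all add: subspace_0[OF subspace_perp])
  ultimately show ?thesis using P(1) by blast
qed

lemma perp_perp:
  assumes "subspace M" "closed M"
  shows "perp (perp M) = M"
proof
  show "perp (perp M) \<subseteq> M"
  proof
    fix x assume x: "x \<in> perp (perp M)"
    obtain m where m: "m \<in> M" "x - m \<in> perp M" using perp_decomposition[OF assms] by blast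
    have "x - m \<in> perp (perp M)"
      using x m(1) perp_perp_superset subspace_perp subspace_diff by blast
    then show "x \<in> M" using perp_Int_self m by fastforce
  qed
qed (rule perp_perp_superset)

text \<open>Only the component \<open>g\<close> of the new vector orthogonal to \<open>M\<close> matters. The span is then the
  set of the \<open>x\<close> whose error after projecting to the line through \<open>g\<close> lies in \<open>M\<close>, a preimage
  of \<open>M\<close> under a continuous map.\<close>

lemma closed_span_insert:
  assumes M: "subspace M" "closed M"
  shows "closed (span (insert f M))"
proof -
  obtain m where m: "m \<in> M" "f - m \<in> perp M" using perp_decomposition[OF M] by blast
  define g where "g = f - m"
  have span_M: "span M = M" using M(1) by (simp add: span_eq_iff)
  let ?h = "\<lambda>x. x - scl (ip x g / of_real ((norm g)\<^sup>2)) g"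
  have "x \<in> span (insert f M) \<longleftrightarrow> ?h x \<in> M" for x
  proof
    assume "x \<in> span (insert f M)"
    then obtain k where k: "x - scl k f \<in> M" unfolding span_insert span_M by blast
    then have "x - scl k f + scl k m \<in> M" by (intro subspace_add subspace_scale M m)
    moreover have "x - scl k f + scl k m = x - scl k g"
      by (simp add: g_def scale_right_diff_distrib)
    ultimately have kg: "x - scl k g \<in> M" by simp
    then have "ip g (x - scl k g) = 0" using m(2) by (simp add: perp_def g_def)
    then have "ip (x - scl k g) g = 0" by (simp add: ip_eq_zero_commute)
    then have "ip x g = k * of_real ((norm g)\<^sup>2)"
      by (simp add: ip_diff_left ip_scale_left ip_self)
    then have "?h x = x - scl k g" by (cases "g = 0") simp_all
    then show "?h x \<in> M" using kg by (simp only:)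
  next
    assume "?h x \<in> M"
    then have 1: "?h x \<in> span (insert f M)" by (intro span_base) simp
    have "g \<in> span (insert f M)"
      unfolding g_def by (intro span_diff span_base) (use m(1) in auto)
    then have "?h x + scl (ip x g / of_real ((norm g)\<^sup>2)) g \<in> span (insert f M)"
      by (intro span_add[OF 1] span_scale)
    then show "x \<in> span (insert f M)" by simp
  qed
  then have "span (insert f M) = ?h -` M" by auto
  moreover have "bounded_linear (\<lambda>x. scl (ip x g / of_real ((norm g)\<^sup>2)) g)"
    by (intro bounded_linear_compose[OF bounded_linear_scale_left]
        bounded_linear_compose[OF bounded_linear_divide] bounded_linear_ip_left)
  ultimately show ?thesis
    by (simp add: closed_vimage[OF M(2)] continuous_on_diff linear_continuous_on)
qed

lemma closed_span_Un_finite: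
  assumes M: "subspace M" "closed M" and "finite B"
  shows "closed (span (B \<union> M))"
  using \<open>finite B\<close>
proof induction
  case empty
  have "span M = M" using M(1) by (simp add: span_eq_iff)
  then show ?case using M(2) by (simp only: Un_empty_left)
next
  case (insert b B)
  have "closed (span (insert b (span (B \<union> M))))"
    by (intro closed_span_insert subspace_span insert.IH)
  also have "span (insert b (span (B \<union> M))) = span (insert b B \<union> M)"
    using span_Un[of "{b}" "B \<union> M"] span_Un[of "{b}" "span (B \<union> M)"] by (simp add: span_span)
  finally show ?case .
qed

text \<open>The Riesz representation theorem. The kernel of \<open>f\<close> has codimension one, so any vector
  orthogonal to it on which \<open>f\<close> does not vanish represents \<open>f\<close> up to a scalar.\<close>

lemma riesz_representation:
  assumes f: "Vector_Spaces.linear scl (*) f" and C: "\<And>x. norm (f x) \<le> C * norm x"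
  shows "\<exists>z. \<forall>x. f x = ip x z"
proof (cases "\<forall>x. f x = 0")
  case True
  then show ?thesis by (intro exI[of _ 0]) simp
next
  case False
  then obtain u where u: "f u \<noteq> 0" by blast
  interpret f: Vector_Spaces.linear scl "(*)" f by fact
  have "bounded_linear f"
    by (rule bounded_linear_intro[of _ C])
      (simp_all add: f.add f.scale C mult.commute[of _ C] scale_of_real[symmetric] scaleR_conv_of_real)
  then have "closed (f -` {0})"
    by (intro closed_vimage closed_singleton linear_continuous_on)
  moreover have "subspace (f -` {0})"
    by (auto simp: subspace_def f.add f.scale f.zero)
  ultimately obtain m where m: "f m = 0" "u - m \<in> perp (f -` {0})"
    using perp_decomposition by blast
  define w where "w = u - m"
  have fw: "f w \<noteq> 0" using u m(1) by (simp add: w_def f.diff)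
  then have "w \<noteq> 0" using f.zero by auto
  then have ww: "ip w w \<noteq> 0" by simp
  have "f x = ip x (scl (scalar_cnj (f w / ip w w)) w)" for x
  proof -
    have "f (x - scl (f x / f w) w) = 0" using fw by (simp add: f.diff f.scale)
    then have "ip w (x - scl (f x / f w) w) = 0" using m(2) by (simp add: perp_def w_def)
    then have "ip (x - scl (f x / f w) w) w = 0" by (simp add: ip_eq_zero_commute)
    then have "ip x w = f x / f w * ip w w" by (simp add: ip_diff_left ip_scale_left)
    then show ?thesis
      using fw ww by (simp add: ip_scale_right scalar_cnj_cnj)
  qed
  then show ?thesis by blast
qed

end

section \<open>Adjoints and operators with complemented range\<close>

locale hilbert_operator =
  H1: hilbert_space scl1 ip1 + H2: hilbert_space scl2 ip2
  for scl1 :: "'k::hilbert_scalar \<Rightarrow> 'a::banach \<Rightarrow> 'a" and ip1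
    and scl2 :: "'k \<Rightarrow> 'b::banach \<Rightarrow> 'b" and ip2 +
  fixes S :: "'a \<Rightarrow> 'b"
  assumes bounded_operator: "S \<in> bounded_operators scl1 scl2"
begin

sublocale S: Vector_Spaces.linear scl1 scl2 S
  using bounded_operator by (simp add: bounded_operators_def)

lemma bounded: "\<exists>C\<ge>0. \<forall>x. norm (S x) \<le> C * norm x"
proof -
  obtain C where C: "\<And>x. norm (S x) \<le> C * norm x"
    using bounded_operator by (auto simp: bounded_operators_def)
  have "norm (S x) \<le> \<bar>C\<bar> * norm x" for x
    using C[of x] mult_right_mono[OF abs_ge_self[of C] norm_ge_zero[of x]] by linarith
  then show ?thesis by (intro exI[of _ "\<bar>C\<bar>"]) simp
qed

lemma bounded_linear: "bounded_linear S"
proof -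
  obtain C where "\<And>x. norm (S x) \<le> C * norm x" using bounded by blast
  then show ?thesis
    by (intro bounded_linear_intro[of _ C])
      (simp_all add: S.add S.scale mult.commute[of _ C] H1.scale_of_real[symmetric]
        H2.scale_of_real[symmetric])
qed

lemma subspace_range: "H2.subspace (range S)"
  by (rule S.subspace_image) (rule H1.subspace_UNIV)

lemma subspace_null_space: "H1.subspace (null_space S)"
  by (auto simp: null_space_def H1.subspace_def S.add S.scale S.zero)

lemma closed_null_space: "closed (null_space S)"
proof -
  have "null_space S = S -` {0}" by (auto simp: null_space_def)
  then show ?thesis
    by (simp add: closed_vimage linear_continuous_on[OF bounded_linear])
qed

abbreviation adj :: "'b \<Rightarrow> 'a" where
  "adj \<equiv> hilbert_adjoint ip1 ip2 S"

lemma adjoint_unique: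
  assumes "\<And>x y. ip2 (S x) y = ip1 x (S' y)"
  shows "adj = S'"
  unfolding hilbert_adjoint_def
proof (rule the_equality)
  fix T
  assume "\<forall>x y. ip2 (S x) y = ip1 x (T y)"
  then show "T = S'" using assms by (intro ext H1.ip_eqI) metis
qed (use assms in blast)

lemma adjoint_exists: "\<exists>S'. \<forall>x y. ip2 (S x) y = ip1 x (S' y)"
proof -
  obtain C where C: "\<And>x. norm (S x) \<le> C * norm x" using bounded by blast
  have "\<exists>z. \<forall>x. ip2 (S x) y = ip1 x z" for y
  proof (rule H1.riesz_representation)
    have "vector_space ((*) :: 'k \<Rightarrow> 'k \<Rightarrow> 'k)"
      by unfold_locales (simp_all add: algebra_simps)
    then show "Vector_Spaces.linear scl1 (*) (\<lambda>x. ip2 (S x) y)"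
      using H1.vector_space_axioms
      by (simp add: Vector_Spaces.linear_iff S.add S.scale H2.ip_add_left H2.ip_scale_left)
    have "norm (ip2 (S x) y) \<le> norm (S x) * norm y" for x by (rule H2.cauchy_schwarz)
    also have "norm (S x) * norm y \<le> C * norm x * norm y" for x
      by (intro mult_right_mono C) simp
    finally show "norm (ip2 (S x) y) \<le> (C * norm y) * norm x" for x by (simp add: mult_ac)
  qed
  then show ?thesis by metis
qed

lemma adjoint: "ip2 (S x) y = ip1 x (adj y)"
  using adjoint_exists adjoint_unique by metis

lemma adjoint_left: "ip1 (adj y) x = ip2 y (S x)"
  by (simp only: H1.ip_cnj[of "adj y" x] H2.ip_cnj[of y "S x"] adjoint)

lemma adjoint_bounded_operator: "adj \<in> bounded_operators scl2 scl1"
proof -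
  have "Vector_Spaces.linear scl2 scl1 adj"
    unfolding Vector_Spaces.linear_iff
    using H1.vector_space_axioms H2.vector_space_axioms
    by (auto intro!: H1.ip_eqI
        simp: adjoint[symmetric] H1.ip_add_right H2.ip_add_right H1.ip_scale_right H2.ip_scale_right)
  moreover
  obtain C where "C \<ge> 0" and C: "\<And>x. norm (S x) \<le> C * norm x" using bounded by blast
  have "norm (adj y) \<le> C * norm y" for y
  proof (cases "adj y = 0")
    case True
    then show ?thesis using \<open>C \<ge> 0\<close> by simp
  next
    case False
    have "(norm (adj y))\<^sup>2 = norm (ip1 (adj y) (adj y))" by (simp add: H1.ip_self norm_power)
    also have "\<dots> = norm (ip2 (S (adj y)) y)" by (simp add: adjoint)
    also have "\<dots> \<le> norm (S (adj y)) * norm y" by (rule H2.cauchy_schwarz)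
    also have "\<dots> \<le> C * norm (adj y) * norm y" by (intro mult_right_mono C) simp
    finally have "norm (adj y) * norm (adj y) \<le> norm (adj y) * (C * norm y)"
      by (simp add: power2_eq_square mult_ac)
    then show ?thesis using False by simp
  qed
  ultimately show ?thesis by (auto simp: bounded_operators_def)
qed

lemma hilbert_operator_adjoint: "hilbert_operator scl2 ip2 scl1 ip1 adj"
  by (intro hilbert_operator.intro hilbert_operator_axioms.intro adjoint_bounded_operator
      H1.hilbert_space_axioms H2.hilbert_space_axioms)

lemma adjoint_adjoint: "hilbert_adjoint ip2 ip1 adj = S"
  by (rule hilbert_operator.adjoint_unique[OF hilbert_operator_adjoint]) (rule adjoint_left)

lemma null_space_adjoint: "null_space adj = H2.perp (range S)"
proof -
  have "adj y = 0 \<longleftrightarrow> (\<forall>x. ip1 (adj y) x = 0)" for y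
    by (metis H1.ip_self_eq_zero H1.ip_zero_left)
  then show ?thesis by (auto simp: null_space_def H2.perp_def adjoint_left)
qed

lemma range_adjoint_subset: "range adj \<subseteq> H1.perp (null_space S)"
  by (auto simp: null_space_def H1.perp_def adjoint_left)

text \<open>If the range has an algebraic complement \<open>D\<close> that is closed, then the bounded map
  \<open>(x, y) \<mapsto> S x + P y\<close>, with \<open>P\<close> the orthogonal projection to \<open>D\<close>, is onto. By the open mapping
  theorem the range component of a vector has a preimage of comparable size.\<close>

lemma bounded_preimage_mod_complement:
  assumes D: "H2.subspace D" "closed D" and sum: "\<And>y. \<exists>x. y - S x \<in> D"
  shows "\<exists>C. \<forall>y. \<exists>x. y - S x \<in> D \<and> norm x \<le> C * norm y"
proof -
  obtain P where P: "bounded_linear P" "\<And>y. P y \<in> D" "\<And>y. y \<in> D \<Longrightarrow> P y = y"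
    using H2.bounded_linear_projection[OF D] by blast
  let ?A = "\<lambda>z. S (fst z) + P (snd z)"
  have "bounded_linear ?A"
    by (intro bounded_linear_add bounded_linear_compose[OF bounded_linear bounded_linear_fst]
        bounded_linear_compose[OF P(1) bounded_linear_snd])
  moreover have "\<exists>z. y = ?A z" for y
  proof -
    obtain x where "y - S x \<in> D" using sum by blast
    then have "y = ?A (x, y - S x)" by (simp add: P(3))
    then show ?thesis by blast
  qed
  then have "surj ?A" unfolding surj_def by blast
  ultimately obtain C where C: "\<And>y. \<exists>z. ?A z = y \<and> norm z \<le> C * norm y"
    using bounded_linear_surj_bounded_preimage by blast
  have "\<exists>x. y - S x \<in> D \<and> norm x \<le> C * norm y" for y
  proof -
    obtain z where z: "?A z = y" "norm z \<le> C * norm y" using C by blast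
    have "y - S (fst z) = P (snd z)" using z(1) by (simp add: algebra_simps)
    moreover have "norm (fst z) \<le> C * norm y" using norm_fst_le[of "fst z" "snd z"] z(2) by simp
    ultimately show ?thesis using P(2) by metis
  qed
  then show ?thesis by blast
qed

lemma range_component_unique:
  assumes D: "H2.subspace D" and direct: "range S \<inter> D \<subseteq> {0}"
    and "y - S x \<in> D" "y - S x' \<in> D"
  shows "S (x - x') = 0"
proof -
  have "(y - S x') - (y - S x) \<in> D" by (intro H2.subspace_diff assms)
  then have "S (x - x') \<in> D" by (simp add: S.diff)
  then show ?thesis using direct by blast
qed

text \<open>If \<open>S u\<^sub>n\<close> tends to \<open>y\<close>, the range component of \<open>y - S u\<^sub>n\<close> tends to \<open>0\<close>; adding
  \<open>S u\<^sub>n\<close> to it always gives the range component of \<open>y\<close>, which is therefore \<open>y\<close>.\<close>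

lemma closed_range_of_closed_complement:
  assumes D: "H2.subspace D" "closed D" and direct: "range S \<inter> D \<subseteq> {0}"
    and sum: "\<And>y. \<exists>x. y - S x \<in> D"
  shows "closed (range S)"
  unfolding closed_sequential_limits
proof (intro allI impI, elim conjE)
  fix f y
  assume f: "\<forall>n. f n \<in> range S" and lim: "f \<longlonglongrightarrow> y"
  define u where "u n = inv_into UNIV S (f n)" for n
  have u: "f n = S (u n)" for n using f by (simp add: u_def f_inv_into_f)
  obtain C g where g: "\<And>y. y - S (g y) \<in> D" "\<And>y. norm (g y) \<le> C * norm y"
    using bounded_preimage_mod_complement[OF D sum] by metis
  have S_eq: "f n + S (g (y - f n)) = S (g y)" for n
  proof -
    have "y - S (u n + g (y - f n)) \<in> D"
      using g(1)[of "y - f n"] by (simp add: S.add u diff_diff_eq)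
    from range_component_unique[OF D(1) direct this g(1)[of y]]
    show ?thesis by (simp add: S.add S.diff u)
  qed
  have lim0: "(\<lambda>n. y - f n) \<longlonglongrightarrow> 0"
    using tendsto_diff[OF tendsto_const lim, of y] by simp
  have "(\<lambda>n. C * norm (y - f n)) \<longlonglongrightarrow> C * norm (0 :: 'b)"
    by (intro tendsto_mult tendsto_norm tendsto_const lim0)
  then have "(\<lambda>n. g (y - f n)) \<longlonglongrightarrow> 0"
    by (intro Lim_null_comparison[OF always_eventually[OF allI[OF g(2)]]]) simp
  then have "(\<lambda>n. S (g (y - f n))) \<longlonglongrightarrow> S 0"
    by (rule bounded_linear.tendsto[OF bounded_linear])
  then have "(\<lambda>n. f n + S (g (y - f n))) \<longlonglongrightarrow> y + 0"
    by (intro tendsto_add lim) (simp add: S.zero)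
  then have "S (g y) = y" unfolding S_eq LIMSEQ_const_iff by simp
  then show "y \<in> range S" by (metis rangeI)
qed

text \<open>For \<open>y\<close> orthogonal to the null space, sending a vector with range component \<open>S x\<close> to the
  inner product of \<open>x\<close> with \<open>y\<close> is a well-defined bounded functional. The vector that represents
  it is a preimage of \<open>y\<close> under the adjoint.\<close>

lemma range_adjoint_of_closed_complement:
  assumes D: "H2.subspace D" "closed D" and direct: "range S \<inter> D \<subseteq> {0}"
    and sum: "\<And>y. \<exists>x. y - S x \<in> D"
  shows "range adj = H1.perp (null_space S)"
proof
  show "H1.perp (null_space S) \<subseteq> range adj"
  proof
    fix y
    assume y: "y \<in> H1.perp (null_space S)"
    obtain C g where g: "\<And>v. v - S (g v) \<in> D" "\<And>v. norm (g v) \<le> C * norm v"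
      using bounded_preimage_mod_complement[OF D sum] by metis
    have val: "ip1 (g v) y = ip1 x y" if "v - S x \<in> D" for v x
    proof -
      have "g v - x \<in> null_space S"
        using range_component_unique[OF D(1) direct g(1) that] by (simp add: null_space_def)
      then have "ip1 y (g v - x) = 0" using y by (simp add: H1.perp_def)
      then have "ip1 (g v - x) y = 0" by (subst H1.ip_eq_zero_commute)
      then show ?thesis by (simp add: H1.ip_diff_left)
    qed
    have "\<exists>z. \<forall>v. ip1 (g v) y = ip2 v z"
    proof (rule H2.riesz_representation)
      have add: "ip1 (g (v + w)) y = ip1 (g v) y + ip1 (g w) y" for v w
      proof -
        have "(v - S (g v)) + (w - S (g w)) \<in> D" by (intro H2.subspace_add D g)
        then have "(v + w) - S (g v + g w) \<in> D" by (simp add: S.add algebra_simps)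
        from val[OF this] show ?thesis by (simp add: H1.ip_add_left)
      qed
      have scale: "ip1 (g (scl2 c v)) y = c * ip1 (g v) y" for c v
      proof -
        have "scl2 c (v - S (g v)) \<in> D" by (intro H2.subspace_scale D g)
        then have "scl2 c v - S (scl1 c (g v)) \<in> D"
          by (simp add: S.scale H2.scale_right_diff_distrib)
        from val[OF this] show ?thesis by (simp add: H1.ip_scale_left)
      qed
      have "vector_space ((*) :: 'k \<Rightarrow> 'k \<Rightarrow> 'k)"
        by unfold_locales (simp_all add: algebra_simps)
      then show "Vector_Spaces.linear scl2 (*) (\<lambda>v. ip1 (g v) y)"
        using H2.vector_space_axioms by (simp add: Vector_Spaces.linear_iff add scale)
      have "norm (ip1 (g v) y) \<le> norm (g v) * norm y" for v by (rule H1.cauchy_schwarz)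
      also have "norm (g v) * norm y \<le> C * norm v * norm y" for v
        by (intro mult_right_mono g) simp
      finally show "norm (ip1 (g v) y) \<le> (C * norm y) * norm v" for v by (simp add: mult_ac)
    qed
    then obtain z where z: "\<And>v. ip1 (g v) y = ip2 v z" by blast
    have "ip1 x (adj z) = ip1 x y" for x
    proof -
      have "ip1 (g (S x)) y = ip1 x y" by (rule val) (simp add: H2.subspace_0 D)
      then show ?thesis using z[of "S x"] by (simp add: adjoint)
    qed
    then have "adj z = y" by (rule H1.ip_eqI)
    then show "y \<in> range adj" by (metis rangeI)
  qed
qed (rule range_adjoint_subset)

end

section \<open>Dimensions of quotients\<close>

context vector_space
begin

lemma coset_eq_iff:
  assumes "subspace W"
  shows "x +o W = y +o W \<longleftrightarrow> x - y \<in> W"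
proof
  assume "x +o W = y +o W"
  moreover have "x + 0 \<in> x +o W" unfolding elt_set_plus_def using subspace_0[OF assms] by blast
  ultimately have "x \<in> y +o W" by simp
  then show "x - y \<in> W" by (auto simp: elt_set_plus_def)
next
  assume xy: "x - y \<in> W"
  show "x +o W = y +o W"
  proof (intro subset_antisym subsetI)
    fix z assume "z \<in> x +o W"
    then obtain w where w: "w \<in> W" "z = x + w" by (auto simp: elt_set_plus_def)
    have "(x - y) + w \<in> W" by (intro subspace_add assms xy w)
    moreover have "z = y + ((x - y) + w)" using w by simp
    ultimately show "z \<in> y +o W" unfolding elt_set_plus_def by blast
  next
    fix z assume "z \<in> y +o W"
    then obtain w where w: "w \<in> W" "z = y + w" by (auto simp: elt_set_plus_def)
    have "w - (x - y) \<in> W" by (intro subspace_diff assms xy w)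
    moreover have "z = x + (w - (x - y))" using w by simp
    ultimately show "z \<in> x +o W" unfolding elt_set_plus_def by blast
  qed
qed

lemma coset_add:
  assumes "subspace W"
  shows "(x +o W) + (y +o W) = (x + y) +o W"
proof -
  have "W + W = W"
  proof (intro subset_antisym subsetI)
    fix z assume "z \<in> W"
    then have "z + 0 \<in> W + W" using subspace_0[OF assms] by (intro set_plus_intro)
    then show "z \<in> W + W" by simp
  qed (auto simp: set_plus_def intro: subspace_add[OF assms])
  then show ?thesis by (simp add: set_plus_rearrange)
qed

lemma coset_scale:
  assumes "subspace W"
  shows "scale c ` (x +o W) + W = scale c x +o W"
proof (intro subset_antisym subsetI)
  fix z assume "z \<in> scale c ` (x +o W) + W"
  then obtain w v where w: "w \<in> W" "v \<in> W" "z = scale c (x + w) + v"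
    by (auto simp: set_plus_def elt_set_plus_def)
  have "scale c w + v \<in> W" by (intro subspace_add subspace_scale assms w)
  moreover have "z = scale c x + (scale c w + v)"
    using w by (simp add: scale_right_distrib add.assoc)
  ultimately show "z \<in> scale c x +o W" unfolding elt_set_plus_def by blast
next
  fix z assume "z \<in> scale c x +o W"
  then obtain w where w: "w \<in> W" "z = scale c (x + 0) + w" by (auto simp: elt_set_plus_def)
  then show "z \<in> scale c ` (x +o W) + W"
    using subspace_0[OF assms] unfolding set_plus_def elt_set_plus_def by blast
qed

text \<open>Cosets of vectors in \<open>B\<close> generate the quotient exactly if \<open>B\<close> generates \<open>V\<close> modulo \<open>W\<close>:
  the cosets of vectors of \<open>span (B \<union> W)\<close> form a submodule, and the vectors whose coset lies in a
  given submodule form a subspace that contains \<open>W\<close>.\<close>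

lemma gen_set_quotient_space_iff:
  assumes V: "subspace V" and W: "subspace W" "W \<subseteq> V" and B: "B \<subseteq> V"
  shows "LinearCombinations.module.span scalar_ring (quotient_space scale V W) ((\<lambda>x. x +o W) ` B) =
    carrier (quotient_space scale V W) \<longleftrightarrow> V \<subseteq> span (B \<union> W)"
proof -
  let ?Q = "quotient_space scale V W"
  let ?c = "\<lambda>x. x +o W"
  interpret Q: vectorspace scalar_ring ?Q
    by (rule vectorspace_quotient_space) (intro vector_space_axioms V W)+
  have carrier: "carrier ?Q = ?c ` V" and zero: "\<zero>\<^bsub>?Q\<^esub> = 0 +o W"
    and add: "\<And>x y. ?c x \<oplus>\<^bsub>?Q\<^esub> ?c y = ?c (x + y)"
    and scale: "\<And>k x. k \<odot>\<^bsub>?Q\<^esub> ?c x = ?c (scale k x)"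
    by (simp_all add: quotient_space_def coset_add coset_scale W)
  have B_carrier: "?c ` B \<subseteq> carrier ?Q" using B carrier by blast
  show ?thesis
  proof
    assume gen: "Q.span (?c ` B) = carrier ?Q"
    have "span (B \<union> W) \<subseteq> V" by (intro span_minimal V) (use B W in blast)
    then have "LinearCombinations.submodule scalar_ring (?c ` span (B \<union> W)) ?Q"
    proof (intro LinearCombinations.submodule.intro)
      show "\<zero>\<^bsub>?Q\<^esub> \<in> ?c ` span (B \<union> W)" unfolding zero by (intro imageI span_zero)
    qed (auto simp: carrier add scale intro!: imageI span_add span_scale Q.module_axioms)
    moreover have "?c ` B \<subseteq> ?c ` span (B \<union> W)" using span_superset by blast
    ultimately have cover: "carrier ?Q \<subseteq> ?c ` span (B \<union> W)"
      using Q.span_is_subset gen by metis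
    show "V \<subseteq> span (B \<union> W)"
    proof
      fix x assume "x \<in> V"
      then obtain y where y: "y \<in> span (B \<union> W)" "?c x = ?c y"
        using cover carrier by blast
      then have "x - y \<in> span (B \<union> W)"
        using coset_eq_iff[OF W(1)] span_superset by blast
      then have "(x - y) + y \<in> span (B \<union> W)" using y(1) by (rule span_add)
      then show "x \<in> span (B \<union> W)" by simp
    qed
  next
    assume gen: "V \<subseteq> span (B \<union> W)"
    interpret N: LinearCombinations.submodule scalar_ring "Q.span (?c ` B)" ?Q
      by (rule Q.span_is_submodule[OF B_carrier])
    let ?U = "{x. ?c x \<in> Q.span (?c ` B)}"
    have U: "subspace ?U"
    proof (rule subspaceI)
      show "0 \<in> ?U" using N.zero_closed by (simp only: zero mem_Collect_eq)
      show "x + y \<in> ?U" if "x \<in> ?U" "y \<in> ?U" for x y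
        using N.m_closed[of "?c x" "?c y"] that by (simp only: add mem_Collect_eq)
      show "scale k x \<in> ?U" if "x \<in> ?U" for k x
        using N.smult_closed[of k "?c x"] that
        by (simp only: scale mem_Collect_eq) (simp add: scalar_ring_def)
    qed
    have B_U: "B \<subseteq> ?U" using Q.in_own_span[OF B_carrier] by blast
    have W_U: "W \<subseteq> ?U"
    proof
      fix w assume "w \<in> W"
      then have "?c w = ?c 0" by (subst coset_eq_iff[OF W(1)]) simp
      then show "w \<in> ?U" using N.zero_closed by (simp only: zero mem_Collect_eq)
    qed
    have "span (B \<union> W) \<subseteq> ?U" by (rule span_minimal[OF Un_least[OF B_U W_U] U])
    then have "V \<subseteq> ?U" using gen by (rule subset_trans[rotated])
    then have "carrier ?Q \<subseteq> Q.span (?c ` B)" unfolding carrier by (intro image_subsetI) auto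
    then show "Q.span (?c ` B) = carrier ?Q"
      using Q.span_is_subset2[OF B_carrier] by blast
  qed
qed

lemma fin_dim_quotientI:
  assumes VW: "subspace V" "subspace W" "W \<subseteq> V"
    and B: "finite B" "B \<subseteq> V" "V \<subseteq> span (B \<union> W)"
  shows "fin_dim_quotient scale V W" and "dim_quotient scale V W \<le> card B"
proof -
  interpret Q: vectorspace scalar_ring "quotient_space scale V W"
    by (rule vectorspace_quotient_space) (intro vector_space_axioms VW)+
  let ?B = "(\<lambda>x. x +o W) ` B"
  have gen: "Q.gen_set ?B" using gen_set_quotient_space_iff[OF VW B(2)] B(3) by blast
  moreover have "?B \<subseteq> carrier (quotient_space scale V W)"
    using B(2) by (auto simp: quotient_space_def)
  ultimately have "finite ?B \<and> ?B \<subseteq> carrier (quotient_space scale V W) \<and> Q.gen_set ?B"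
    using B(1) by blast
  then show "fin_dim_quotient scale V W" unfolding Q.fin_dim_def by blast
  have "dim_quotient scale V W \<le> card ?B"
    unfolding Q.dim_def using \<open>finite ?B \<and> _\<close> by (intro Least_le) blast
  also have "\<dots> \<le> card B" by (rule card_image_le[OF B(1)])
  finally show "dim_quotient scale V W \<le> card B" .
qed

lemma fin_dim_quotientE:
  assumes VW: "subspace V" "subspace W" "W \<subseteq> V" and fin: "fin_dim_quotient scale V W"
  obtains B where "finite B" "B \<subseteq> V" "V \<subseteq> span (B \<union> W)" "card B \<le> dim_quotient scale V W"
proof -
  interpret Q: vectorspace scalar_ring "quotient_space scale V W"
    by (rule vectorspace_quotient_space) (intro vector_space_axioms VW)+
  let ?P = "\<lambda>n A. finite A \<and> card A = n \<and> A \<subseteq> carrier (quotient_space scale V W) \<and> Q.gen_set A"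
  have "\<exists>n A. ?P n A" using fin unfolding Q.fin_dim_def by blast
  then have "\<exists>A. ?P (dim_quotient scale V W) A" unfolding Q.dim_def by (rule LeastI_ex)
  then obtain A where A: "?P (dim_quotient scale V W) A" by blast
  then have "A \<subseteq> (\<lambda>x. x +o W) ` V" by (simp add: quotient_space_def)
  then obtain B where B: "B \<subseteq> V" "inj_on (\<lambda>x. x +o W) B" "A = (\<lambda>x. x +o W) ` B"
    using subset_image_inj[of A "\<lambda>x. x +o W" V] by blast
  have "finite B" using A B finite_image_iff by blast
  moreover have "card B \<le> dim_quotient scale V W" using A B card_image by fastforce
  moreover have "V \<subseteq> span (B \<union> W)"
    using gen_set_quotient_space_iff[OF VW B(1)] A B(3) by blast
  ultimately show thesis using that B(1) by blast
qed

text \<open>Discarding a vector that the others generate modulo \<open>W\<close> keeps the span, and a nontrivial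
  relation modulo \<open>W\<close> that involves a new vector would make it such a vector.\<close>

lemma finite_independent_mod_subspace:
  assumes "subspace W" "finite B"
  obtains B' where "B' \<subseteq> B" "B \<subseteq> span (B' \<union> W)" "span B' \<inter> W \<subseteq> {0}"
proof -
  have "\<exists>B'\<subseteq>B. B \<subseteq> span (B' \<union> W) \<and> span B' \<inter> W \<subseteq> {0}"
    using \<open>finite B\<close>
  proof induction
    case (insert b B)
    obtain B' where B': "B' \<subseteq> B" "B \<subseteq> span (B' \<union> W)" "span B' \<inter> W \<subseteq> {0}"
      using insert.IH by (elim exE conjE) (rule that)
    show ?case
    proof (cases "b \<in> span (B' \<union> W)")
      case True
      then have "insert b B \<subseteq> span (B' \<union> W)" using B'(2) by simp
      moreover have "B' \<subseteq> insert b B" using B'(1) by (rule subset_insertI2)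
      ultimately show ?thesis using B'(3) by (intro exI[of _ B'] conjI)
    next
      case False
      have zero: "x = 0" if x: "x \<in> span (insert b B')" "x \<in> W" for x
      proof -
        obtain k where k: "x - scale k b \<in> span B'" using x(1) unfolding span_insert by blast
        have "k = 0"
        proof (rule ccontr)
          assume "k \<noteq> 0"
          have xb: "x - scale k b \<in> span (B' \<union> W)" using k span_mono[of B' "B' \<union> W"] by blast
          have "x \<in> span (B' \<union> W)" using x(2) by (intro span_base) blast
          then have "x - (x - scale k b) \<in> span (B' \<union> W)" using xb by (rule span_diff)
          moreover have "x - (x - scale k b) = scale k b" by simp
          ultimately have "scale k b \<in> span (B' \<union> W)" by (simp only:)
          then have "scale (inverse k) (scale k b) \<in> span (B' \<union> W)"
            by (rule span_scale)
          then show False using False \<open>k \<noteq> 0\<close> by simp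
        qed
        then have "x \<in> span B' \<inter> W" using k x(2) by simp
        then show ?thesis using B'(3) by (auto simp only:)
      qed
      then have "span (insert b B') \<inter> W \<subseteq> {0}" by (intro subsetI) (simp add: zero)
      moreover have "insert b B \<subseteq> span (insert b B' \<union> W)"
        using B'(2) span_mono[of "B' \<union> W" "insert b B' \<union> W"] span_base[of b "insert b B' \<union> W"] by blast
      moreover have "insert b B' \<subseteq> insert b B" using B'(1) by (rule insert_mono)
      ultimately show ?thesis by (intro exI[of _ "insert b B'"] conjI)
    qed
  qed simp
  then show thesis by (elim exE conjE) (rule that)
qed

text \<open>Each functional lowers the dimension by at most one: a vector of the current kernel on which
  the next functional does not vanish generates that kernel modulo the next.\<close>

lemma common_kernel_codimension:
  assumes V: "subspace V" and "finite B"
    and add: "\<And>b x y. f b (x + y) = f b x + f b y"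
    and scale: "\<And>b c x. f b (scale c x) = c * f b x"
  obtains C where "finite C" "C \<subseteq> V" "card C \<le> card B"
    "V \<subseteq> span (C \<union> {x\<in>V. \<forall>b\<in>B. f b x = 0})"
proof -
  have "\<exists>C. finite C \<and> C \<subseteq> V \<and> card C \<le> card B \<and> V \<subseteq> span (C \<union> {x\<in>V. \<forall>b\<in>B. f b x = 0})"
    using \<open>finite B\<close>
  proof induction
    case empty
    have "V \<subseteq> span V" by (rule span_superset)
    then show ?case by (intro exI[of _ "{}"]) simp
  next
    case (insert b B)
    let ?K = "{x\<in>V. \<forall>b\<in>B. f b x = 0}" and ?K' = "{x\<in>V. \<forall>b\<in>insert b B. f b x = 0}"
    obtain C where C: "finite C" "C \<subseteq> V" "card C \<le> card B" "V \<subseteq> span (C \<union> ?K)"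
      using insert.IH by (elim exE conjE) (rule that)
    show ?case
    proof (cases "\<forall>x\<in>?K. f b x = 0")
      case True
      then have "?K' = ?K" by blast
      then show ?thesis using C insert.hyps by (intro exI[of _ C]) auto
    next
      case False
      then obtain c where c: "c \<in> V" "\<And>b. b \<in> B \<Longrightarrow> f b c = 0" "f b c \<noteq> 0" by blast
      let ?S = "span (insert c C \<union> ?K')"
      have "?K \<subseteq> ?S"
      proof
        fix x assume x: "x \<in> ?K"
        let ?k = "- (f b x / f b c)"
        have "x + scale ?k c \<in> V" using x c(1) V by (intro subspace_add subspace_scale) auto
        moreover have "f b' (x + scale ?k c) = 0" if "b' \<in> insert b B" for b'
        proof (cases "b' = b")
          case True
          then show ?thesis unfolding add scale using c(3) by simp
        next
          case False
          then show ?thesis unfolding add scale using that x c(2) by simp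
        qed
        ultimately have "x + scale ?k c \<in> ?K'" by simp
        then have "x + scale ?k c \<in> ?S" by (rule span_base[OF UnI2])
        moreover have "scale ?k c \<in> ?S" by (intro span_scale span_base UnI1 insertI1)
        ultimately have "(x + scale ?k c) - scale ?k c \<in> ?S" by (rule span_diff)
        then show "x \<in> ?S" by simp
      qed
      moreover have "C \<subseteq> ?S"
        by (rule subset_trans[OF subset_insertI subset_trans[OF Un_upper1 span_superset]])
      ultimately have "span (C \<union> ?K) \<subseteq> ?S" by (intro span_minimal subspace_span Un_least)
      with C(4) have "V \<subseteq> ?S" by (rule subset_trans)
      moreover have "card (insert c C) \<le> card (insert b B)"
        using C insert.hyps by (simp add: card_insert_if)
      moreover have "finite (insert c C)" "insert c C \<subseteq> V" using C c(1) by simp_all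
      ultimately show ?thesis by (intro exI[of _ "insert c C"] conjI)
    qed
  qed
  then show thesis by (elim exE conjE) (rule that)
qed

end

section \<open>Duality of quotients in Hilbert spaces\<close>

context hilbert_space
begin

text \<open>Among the vectors orthogonal to \<open>N\<close>, orthogonality to \<open>M\<close> is the vanishing of one functional
  for each of finitely many generators of \<open>M\<close> modulo \<open>M \<inter> N\<close>.\<close>

lemma perp_quotient_dim_le:
  assumes M: "subspace M" and N: "subspace N" and fin: "fin_dim_quotient scl M (M \<inter> N)"
  shows "fin_dim_quotient scl (perp N) (perp N \<inter> perp M)"
    and "dim_quotient scl (perp N) (perp N \<inter> perp M) \<le> dim_quotient scl M (M \<inter> N)"
proof -
  obtain B where B: "finite B" "B \<subseteq> M" "M \<subseteq> span (B \<union> (M \<inter> N))"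
    "card B \<le> dim_quotient scl M (M \<inter> N)"
    by (rule fin_dim_quotientE[OF M subspace_inter[OF M N] Int_lower1 fin])
  obtain C where C: "finite C" "C \<subseteq> perp N" "card C \<le> card B"
    "perp N \<subseteq> span (C \<union> {x \<in> perp N. \<forall>b\<in>B. ip x b = 0})"
    using common_kernel_codimension[OF subspace_perp[of N] B(1), of "\<lambda>b x. ip x b"]
    by (auto simp: ip_add_left ip_scale_left)
  have "{x \<in> perp N. \<forall>b\<in>B. ip x b = 0} \<subseteq> perp (B \<union> (M \<inter> N))" by (auto simp: perp_def)
  also have "\<dots> = perp (span (B \<union> (M \<inter> N)))" by (rule perp_span[symmetric])
  also have "\<dots> \<subseteq> perp M" by (rule perp_antimono[OF B(3)])
  finally have "{x \<in> perp N. \<forall>b\<in>B. ip x b = 0} \<subseteq> perp N \<inter> perp M" by blast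
  then have "span (C \<union> {x \<in> perp N. \<forall>b\<in>B. ip x b = 0}) \<subseteq> span (C \<union> (perp N \<inter> perp M))"
    by (intro span_mono) blast
  then have "perp N \<subseteq> span (C \<union> (perp N \<inter> perp M))" using C(4) by blast
  note * = fin_dim_quotientI[OF subspace_perp subspace_inter[OF subspace_perp subspace_perp] _ C(1,2) this]
  show "fin_dim_quotient scl (perp N) (perp N \<inter> perp M)" by (rule *) blast
  have "dim_quotient scl (perp N) (perp N \<inter> perp M) \<le> card C" by (rule *) blast
  then show "dim_quotient scl (perp N) (perp N \<inter> perp M) \<le> dim_quotient scl M (M \<inter> N)"
    using C(3) B(4) by linarith
qed

text \<open>The inequality for the pair of orthogonal complements is the converse inequality for closed
  subspaces, which are their own double complements.\<close>

lemma perp_quotient_dim_eq: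
  assumes M: "subspace M" "closed M" and N: "subspace N" "closed N"
    and fin: "fin_dim_quotient scl M (M \<inter> N)"
  shows "dim_quotient scl (perp N) (perp N \<inter> perp M) = dim_quotient scl M (M \<inter> N)"
proof (rule antisym)
  show "dim_quotient scl (perp N) (perp N \<inter> perp M) \<le> dim_quotient scl M (M \<inter> N)"
    by (rule perp_quotient_dim_le[OF M(1) N(1) fin])
  show "dim_quotient scl M (M \<inter> N) \<le> dim_quotient scl (perp N) (perp N \<inter> perp M)"
    using perp_quotient_dim_le(2)[OF subspace_perp subspace_perp perp_quotient_dim_le(1)[OF M(1) N(1) fin]]
    by (simp only: perp_perp[OF M] perp_perp[OF N])
qed

text \<open>With \<open>N\<close> generated by finitely many vectors \<open>F\<close> modulo \<open>M \<inter> N\<close>, the sum \<open>L\<close> of \<open>M\<close> and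
  \<open>N\<close> is spanned by \<open>F\<close> and \<open>M\<close>, hence closed. A complement of \<open>N\<close> in the whole space is obtained
  from the orthogonal complement of \<open>L\<close> and a finite basis of \<open>M\<close> modulo \<open>M \<inter> N\<close>.\<close>

lemma closed_complement_exists:
  assumes M: "subspace M" "closed M" and N: "subspace N"
    and finM: "fin_dim_quotient scl M (M \<inter> N)" and finN: "fin_dim_quotient scl N (M \<inter> N)"
  obtains D where "subspace D" "closed D" "N \<inter> D \<subseteq> {0}" "\<And>y. \<exists>n\<in>N. y - n \<in> D"
proof -
  have W: "subspace (M \<inter> N)" by (rule subspace_inter[OF M(1) N])
  obtain B0 where B0: "finite B0" "B0 \<subseteq> M" "M \<subseteq> span (B0 \<union> (M \<inter> N))"
    "card B0 \<le> dim_quotient scl M (M \<inter> N)"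
    by (rule fin_dim_quotientE[OF M(1) W Int_lower1 finM])
  obtain B where B: "B \<subseteq> B0" "B0 \<subseteq> span (B \<union> (M \<inter> N))" "span B \<inter> (M \<inter> N) \<subseteq> {0}"
    by (rule finite_independent_mod_subspace[OF W B0(1)])
  obtain F where F: "finite F" "F \<subseteq> N" "N \<subseteq> span (F \<union> (M \<inter> N))"
    "card F \<le> dim_quotient scl N (M \<inter> N)"
    by (rule fin_dim_quotientE[OF N W Int_lower2 finN])
  define L where "L = span (F \<union> M)"
  have L: "subspace L" "closed L"
    unfolding L_def by (rule subspace_span) (rule closed_span_Un_finite[OF M F(1)])
  have M_L: "M \<subseteq> L" unfolding L_def using span_superset by blast
  have N_L: "N \<subseteq> L" unfolding L_def using F(3) span_mono[of "F \<union> (M \<inter> N)" "F \<union> M"] by blast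
  have span_B_M: "span B \<subseteq> M" using B(1) B0(2) by (intro span_minimal M) blast
  have "B0 \<union> (M \<inter> N) \<subseteq> span (B \<union> N)"
    using B(2) span_mono[of "B \<union> (M \<inter> N)" "B \<union> N"] span_superset[of "B \<union> N"] by blast
  then have "span (B0 \<union> (M \<inter> N)) \<subseteq> span (B \<union> N)" by (intro span_minimal subspace_span)
  then have "F \<union> M \<subseteq> span (B \<union> N)"
    using B0(3) F(2) span_superset[of "B \<union> N"] by blast
  then have L_sub: "L \<subseteq> span (B \<union> N)" unfolding L_def by (intro span_minimal subspace_span)
  define D where "D = span (B \<union> perp L)"
  have D_iff: "x \<in> D \<longleftrightarrow> (\<exists>g\<in>span B. \<exists>p\<in>perp L. x = g + p)" for x
  proof -
    have span_perp_L: "span (perp L) = perp L" by (simp add: span_eq_iff subspace_perp)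
    show ?thesis unfolding D_def span_Un span_perp_L by auto
  qed
  show thesis
  proof (rule that)
    show "subspace D" unfolding D_def by (rule subspace_span)
    show "closed D"
      unfolding D_def using B(1) B0(1)
      by (intro closed_span_Un_finite subspace_perp closed_perp finite_subset[of B B0])
    show "N \<inter> D \<subseteq> {0}"
    proof
      fix x assume x: "x \<in> N \<inter> D"
      then obtain g p where gp: "g \<in> span B" "p \<in> perp L" "x = g + p" using D_iff by blast
      have "x - g \<in> L" using x gp(1) span_B_M N_L M_L by (intro subspace_diff L) blast+
      then have "p = 0" using gp perp_Int_self by auto
      then have "x \<in> span B \<inter> (M \<inter> N)" using gp span_B_M x by auto
      then show "x \<in> {0}" using B(3) by blast
    qed
    show "\<exists>n\<in>N. y - n \<in> D" for y
    proof -
      obtain l where l: "l \<in> L" "y - l \<in> perp L" using perp_decomposition[OF L] by blast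
      have span_N: "span N = N" by (simp add: span_eq_iff N)
      have "l \<in> span (B \<union> N)" using l L_sub by blast
      then obtain g n where gn: "g \<in> span B" "n \<in> N" "l = g + n"
        unfolding span_Un span_N by blast
      have "y - n = g + (y - l)" using gn by (simp add: algebra_simps)
      then show ?thesis using gn l D_iff by blast
    qed
  qed
qed

end

section \<open>Fredholm pairs\<close>

text \<open>The complement of the range of \<open>T\<close> built from the null space of \<open>S\<close> makes the range of \<open>T\<close>
  closed and identifies the range of the adjoint.\<close>

lemma range_closed_of_fredholm_pair:
  assumes S: "hilbert_operator scl1 ip1 scl2 ip2 S" and T: "hilbert_operator scl2 ip2 scl1 ip1 T"
    and fredholm: "fin_dim_quotient scl1 (null_space S) (null_space S \<inter> range T)"
      "fin_dim_quotient scl1 (range T) (null_space S \<inter> range T)"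
  shows "closed (range T)"
    and "range (hilbert_adjoint ip2 ip1 T) = hilbert_space.perp ip2 (null_space T)"
proof -
  interpret S: hilbert_operator scl1 ip1 scl2 ip2 S by fact
  interpret T: hilbert_operator scl2 ip2 scl1 ip1 T by fact
  obtain D where D: "S.H1.subspace D" "closed D" "range T \<inter> D \<subseteq> {0}"
    "\<And>y. \<exists>n\<in>range T. y - n \<in> D"
    by (rule S.H1.closed_complement_exists[OF S.subspace_null_space S.closed_null_space
          T.subspace_range fredholm]) (rule that)
  have sum: "\<exists>x. y - T x \<in> D" for y using D(4)[of y] by blast
  show "closed (range T)" by (rule T.closed_range_of_closed_complement[OF D(1-3) sum])
  show "range (hilbert_adjoint ip2 ip1 T) = hilbert_space.perp ip2 (null_space T)"
    by (rule T.range_adjoint_of_closed_complement[OF D(1-3) sum])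
qed

text \<open>Passing to the adjoint pair replaces the null spaces and ranges by the orthogonal complements
  of the ranges and null spaces in the same space, so that each of the four dimensions is
  preserved.\<close>

lemma fredholm_pair_adjoint:
  assumes S: "hilbert_operator scl1 ip1 scl2 ip2 S" and T: "hilbert_operator scl2 ip2 scl1 ip1 T"
    and fredholm: "fredholm_pair scl1 scl2 S T"
  shows "fredholm_pair scl1 scl2 (hilbert_adjoint ip2 ip1 T) (hilbert_adjoint ip1 ip2 S)"
    and "fredholm_index scl1 scl2 (hilbert_adjoint ip2 ip1 T) (hilbert_adjoint ip1 ip2 S) =
      fredholm_index scl1 scl2 S T"
proof -
  interpret S: hilbert_operator scl1 ip1 scl2 ip2 S by fact
  interpret T: hilbert_operator scl2 ip2 scl1 ip1 T by fact
  have a: "fin_dim_quotient scl1 (null_space S) (null_space S \<inter> range T)"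
    and b: "fin_dim_quotient scl1 (range T) (null_space S \<inter> range T)"
    and c: "fin_dim_quotient scl2 (null_space T) (null_space T \<inter> range S)"
    and d: "fin_dim_quotient scl2 (range S) (null_space T \<inter> range S)"
    using fredholm by (simp_all add: fredholm_pair_def)
  note closed_T = range_closed_of_fredholm_pair(1)[OF S T a b]
  note closed_S = range_closed_of_fredholm_pair(1)[OF T S c d]
  note null = S.null_space_adjoint T.null_space_adjoint
  note range = range_closed_of_fredholm_pair(2)[OF S T a b] range_closed_of_fredholm_pair(2)[OF T S c d]
  note M1 = S.subspace_null_space S.closed_null_space and N1 = T.subspace_range closed_T
  note M2 = T.subspace_null_space T.closed_null_space and N2 = S.subspace_range closed_S
  \<comment> \<open>the quotients of the ranges are instances with the two subspaces exchanged\<close>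
  note b' = b[unfolded Int_commute[of "null_space S"]] and d' = d[unfolded Int_commute[of "null_space T"]]
  note dual = S.H1.perp_quotient_dim_le(1)[OF M1(1) N1(1) a]
    S.H1.perp_quotient_dim_le(1)[OF N1(1) M1(1) b', unfolded Int_commute[of "S.H1.perp (null_space S)"]]
    S.H2.perp_quotient_dim_le(1)[OF M2(1) N2(1) c]
    S.H2.perp_quotient_dim_le(1)[OF N2(1) M2(1) d', unfolded Int_commute[of "S.H2.perp (null_space T)"]]
  show "fredholm_pair scl1 scl2 (hilbert_adjoint ip2 ip1 T) (hilbert_adjoint ip1 ip2 S)"
    unfolding fredholm_pair_def null range
    by (intro conjI dual S.adjoint_bounded_operator T.adjoint_bounded_operator)
  note dual_dim = S.H1.perp_quotient_dim_eq[OF M1 N1 a]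
    S.H1.perp_quotient_dim_eq[OF N1 M1 b', unfolded Int_commute[of "S.H1.perp (null_space S)"]
      Int_commute[of "range T"]]
    S.H2.perp_quotient_dim_eq[OF M2 N2 c]
    S.H2.perp_quotient_dim_eq[OF N2 M2 d', unfolded Int_commute[of "S.H2.perp (null_space T)"]
      Int_commute[of "range S"]]
  show "fredholm_index scl1 scl2 (hilbert_adjoint ip2 ip1 T) (hilbert_adjoint ip1 ip2 S) =
      fredholm_index scl1 scl2 S T"
    unfolding fredholm_index_def null range dual_dim ..
qed

theorem theorem4p3:
  fixes scl1 :: "'k::hilbert_scalar \<Rightarrow> 'a::banach \<Rightarrow> 'a" and ip1 :: "'a \<Rightarrow> 'a \<Rightarrow> 'k"
    and scl2 :: "'k \<Rightarrow> 'b::banach \<Rightarrow> 'b" and ip2 :: "'b \<Rightarrow> 'b \<Rightarrow> 'k"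
    and S :: "'a \<Rightarrow> 'b" and T :: "'b \<Rightarrow> 'a"
  assumes "hilbert_space scl1 ip1" and "hilbert_space scl2 ip2"
    and "S \<in> bounded_operators scl1 scl2" and "T \<in> bounded_operators scl2 scl1"
  shows "hilbert_adjoint ip2 ip1 T \<in> bounded_operators scl1 scl2 \<and>
    hilbert_adjoint ip1 ip2 S \<in> bounded_operators scl2 scl1 \<and>
    (fredholm_pair scl1 scl2 S T \<longleftrightarrow>
      fredholm_pair scl1 scl2 (hilbert_adjoint ip2 ip1 T) (hilbert_adjoint ip1 ip2 S)) \<and>
    (fredholm_pair scl1 scl2 S T \<longrightarrow>
      fredholm_index scl1 scl2 (hilbert_adjoint ip2 ip1 T) (hilbert_adjoint ip1 ip2 S) =
      fredholm_index scl1 scl2 S T)"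
proof -
  have S: "hilbert_operator scl1 ip1 scl2 ip2 S" and T: "hilbert_operator scl2 ip2 scl1 ip1 T"
    using assms by (simp_all add: hilbert_operator_def hilbert_operator_axioms_def)
  interpret S: hilbert_operator scl1 ip1 scl2 ip2 S by (rule S)
  interpret T: hilbert_operator scl2 ip2 scl1 ip1 T by (rule T)
  \<comment> \<open>taking adjoints twice gives back the original pair\<close>
  have "fredholm_pair scl1 scl2 S T"
    if "fredholm_pair scl1 scl2 (hilbert_adjoint ip2 ip1 T) (hilbert_adjoint ip1 ip2 S)"
    using fredholm_pair_adjoint(1)[OF T.hilbert_operator_adjoint S.hilbert_operator_adjoint that]
    unfolding S.adjoint_adjoint T.adjoint_adjoint .
  then show ?thesis
    using fredholm_pair_adjoint[OF S T] S.adjoint_bounded_operator T.adjoint_bounded_operator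
    by blast
qed

end
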